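(* For each integer $n\ge 0$ let $\rho_o(n)$ denote the number of partitions of $n$ in which the largest part $\ell$ appears exactly once, all remaining parts are odd, and the remaining parts (all strictly smaller than $\ell$) form a partition of $\ell$ (the largest part $\ell$ itself may be even or odd). Then $$\sum_{n=0}^{\infty}\rho_o(n)q^n=\frac{1}{(q^2;q^4)_{\infty}}-\frac{q^2}{1-q^4}-1.$$
   Context: A partition of a positive integer $n$ is a way of writing $n$ as a sum of positive integers (parts), listed in non-increasing order; the empty partition has no largest part and is not counted. For $|q|<1$, $(t;q)_0=1$, $(t;q)_n=(1-t)(1-tq)\cdots(1-tq^{n-1})$ for $n>0$, and $(t;q)_\infty=\lim_{n\to\infty}(t;q)_n$. *)

theory Defs
  imports "HOL-Analysis.Analysis" "HOL-Library.Multiset"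
begin

text \<open>A partition is represented by the multiset of its parts, so that rearrangements of
  the parts are identified.\<close>

definition partitions_of :: "nat \<Rightarrow> nat multiset set" where
  "partitions_of n = {P. (\<forall>p \<in># P. p > 0) \<and> sum_mset P = n}"

text \<open>The condition \<^prop>\<open>P \<noteq> {#}\<close> excludes the empty partition, which has no largest part.\<close>

definition rho_o_partitions :: "nat \<Rightarrow> nat multiset set" where
  "rho_o_partitions n = {P \<in> partitions_of n. P \<noteq> {#} \<and>
     (let l = Max_mset P; R = P - {#l#}
      in count P l = 1 \<and> (\<forall>p \<in># R. odd p \<and> p < l) \<and> R \<in> partitions_of l)}"

definition rho_o :: "nat \<Rightarrow> nat" where
  "rho_o n = card (rho_o_partitions n)"

definition qpoch :: "complex \<Rightarrow> complex \<Rightarrow> nat \<Rightarrow> complex" where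
  "qpoch t q n = (\<Prod>k<n. 1 - t * q ^ k)"

definition qpoch_inf :: "complex \<Rightarrow> complex \<Rightarrow> complex" where
  "qpoch_inf t q = lim (qpoch t q)"

text \<open>Finiteness, so that \<^const>\<open>card\<close> is a genuine count in \<^const>\<open>rho_o\<close>.\<close>

lemma finite_partitions_of: "finite (partitions_of n)"
proof -
  have "partitions_of n \<subseteq> mset ` {xs. set xs \<subseteq> {..n} \<and> length xs \<le> n}"
  proof
    fix P assume "P \<in> partitions_of n"
    then have pos: "\<And>p. p \<in># P \<Longrightarrow> p > 0" and s: "sum_mset P = n"
      by (auto simp: partitions_of_def)
    obtain xs where xs: "mset xs = P"
      using ex_mset by blast
    have "size P \<le> sum_mset P"
      using pos
    proof (induction P)
      case (add x P)
      from add.prems[of x] have "x > 0" by simp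
      moreover have "size P \<le> sum_mset P" using add by simp
      ultimately show ?case by simp
    qed simp
    moreover have "p \<le> n" if "p \<in># P" for p
      using sum_mset.remove[OF that] s by simp
    ultimately have "set xs \<subseteq> {..n}" "length xs \<le> n"
      using xs s by auto
    then show "P \<in> mset ` {xs. set xs \<subseteq> {..n} \<and> length xs \<le> n}"
      using xs by blast
  qed
  then show ?thesis
    by (rule finite_subset) (intro finite_imageI finite_lists_length_le finite_atMost)
qed

lemma finite_rho_o_partitions: "finite (rho_o_partitions n)"
  using finite_partitions_of[of n] by (rule rev_finite_subset) (auto simp: rho_o_partitions_def)

end

theory Submission
  imports Defs
begin

text \<open>A partition counted by \<^const>\<open>rho_o\<close> has size \<open>2 * l\<close>, where \<open>l\<close> is its largest part, and removing
  that part leaves an arbitrary partition of \<open>l\<close> into odd parts other than the one-part partition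
  \<open>l\<close> itself. With \<open>x = q\<^sup>2\<close> the series is therefore the generating function of partitions into odd
  parts, minus the sum of \<open>x ^ l\<close> over odd \<open>l\<close>, minus the term for \<open>l = 0\<close>. Euler's product for a
  finite set of parts follows by adjoining one part at a time; Tannery's theorem, with the
  coefficients of the limit at \<open>norm x\<close> as majorant, carries it over to all odd parts.\<close>

section \<open>Counting partitions with parts in a prescribed set\<close>

definition restricted_partitions :: "nat set \<Rightarrow> nat \<Rightarrow> nat multiset set" where
  "restricted_partitions A n = {P \<in> partitions_of n. set_mset P \<subseteq> A}"

lemma finite_restricted_partitions [simp]: "finite (restricted_partitions A n)"
  unfolding restricted_partitions_def using finite_partitions_of by simp

lemma part_le:
  assumes "P \<in> partitions_of n" "p \<in># P"
  shows "p \<le> n"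
  using assms sum_mset.remove[OF assms(2)] by (auto simp: partitions_of_def)

text \<open>All parts of a partition of \<open>n\<close> lie in \<open>{1..n}\<close>, so only that
  portion of the allowed set matters. This is what later lets the infinite set of odd numbers be
  truncated one coefficient at a time.\<close>

lemma restricted_partitions_cong:
  assumes "A \<inter> {1..n} = B \<inter> {1..n}"
  shows "restricted_partitions A n = restricted_partitions B n"
proof -
  have "set_mset P \<subseteq> {1..n}" if "P \<in> partitions_of n" for P
    using that part_le[OF that] by (fastforce simp: partitions_of_def)
  with assms show ?thesis
    unfolding restricted_partitions_def by blast
qed

lemma card_restricted_partitions_empty:
  "card (restricted_partitions {} n) = (if n = 0 then 1 else 0)"
proof -
  have "restricted_partitions {} n = (if n = 0 then {{#}} else {})"
    by (auto simp: restricted_partitions_def partitions_of_def)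
  then show ?thesis by simp
qed

text \<open>Split on whether \<open>a\<close> occurs. If it does, deleting a single copy is
  reversible and may leave further copies, hence \<open>insert a A\<close> again on the right. In
  generating functions this reads G = F + x^a G.\<close>

lemma card_restricted_partitions_insert:
  assumes "a \<notin> A" "a > 0"
  shows "card (restricted_partitions (insert a A) n) = card (restricted_partitions A n) +
           (if a \<le> n then card (restricted_partitions (insert a A) (n - a)) else 0)"
proof -
  let ?R = "restricted_partitions (insert a A)"
  let ?W = "{P \<in> ?R n. a \<in># P}"
  have "?R n = restricted_partitions A n \<union> ?W"
    unfolding restricted_partitions_def by auto
  moreover have "restricted_partitions A n \<inter> ?W = {}"
    using assms unfolding restricted_partitions_def by auto
  ultimately have split: "card (?R n) = card (restricted_partitions A n) + card ?W"
    by (metis (no_types, lifting) card_Un_disjoint finite_Un finite_restricted_partitions)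
  have "card ?W = (if a \<le> n then card (?R (n - a)) else 0)"
  proof (cases "a \<le> n")
    case True
    have "bij_betw (add_mset a) (?R (n - a)) ?W"
    proof (rule bij_betw_byWitness[where f' = "\<lambda>P. P - {#a#}"])
      show "(\<lambda>P. P - {#a#}) ` ?W \<subseteq> ?R (n - a)"
      proof clarify
        fix P assume P: "P \<in> ?R n" "a \<in># P"
        then have "sum_mset (P - {#a#}) = n - a"
          using sum_mset.remove[OF P(2)]
          unfolding restricted_partitions_def partitions_of_def by fastforce
        then show "P - {#a#} \<in> ?R (n - a)"
          using P by (auto simp: restricted_partitions_def partitions_of_def dest: in_diffD)
      qed
    qed (use True assms in \<open>auto simp: restricted_partitions_def partitions_of_def\<close>)
    with True show ?thesis by (simp add: bij_betw_same_card)
  next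
    case False
    then have "?W = {}" using part_le unfolding restricted_partitions_def by blast
    with False show ?thesis by simp
  qed
  with split show ?thesis by simp
qed

section \<open>Euler's product for a finite set of parts\<close>

lemma summable_shift_recurrence:
  fixes f g :: "nat \<Rightarrow> real"
  assumes "summable f" "\<And>n. 0 \<le> f n" "\<And>n. 0 \<le> g n" "0 \<le> c" "c < 1"
    and g: "\<And>n. g n = f n + (if a \<le> n then c * g (n - a) else 0)"
  shows "summable g"
proof (rule summableI_nonneg_bounded)
  fix N
  let ?I = "{n\<in>{..<N}. a \<le> n}"
  have "(\<Sum>n<N. if a \<le> n then c * g (n - a) else 0) = c * (\<Sum>n\<in>?I. g (n - a))"
    unfolding sum_distrib_left by (rule sum.inter_filter[symmetric]) simp
  also have "(\<Sum>n\<in>?I. g (n - a)) = sum g ((\<lambda>n. n - a) ` ?I)"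
    by (subst sum.reindex) (auto intro: inj_onI)
  finally have shifted: "(\<Sum>n<N. if a \<le> n then c * g (n - a) else 0) = c * sum g ((\<lambda>n. n - a) ` ?I)" .
  \<comment> \<open>Lowering indices by \<open>a\<close> keeps them below \<open>N\<close>, so the
    shifted sum is at most the partial sum S of \<open>g\<close>. Hence S \<le>
    \<open>suminf f\<close> + c S, and c < 1 turns this into a bound independent of
    \<open>N\<close>.\<close>
  have "sum g ((\<lambda>n. n - a) ` ?I) \<le> (\<Sum>n<N. g n)"
    using assms(3) by (intro sum_mono2) auto
  then have "c * sum g ((\<lambda>n. n - a) ` ?I) \<le> c * (\<Sum>n<N. g n)"
    using assms(4) by (rule mult_left_mono)
  moreover have "(\<Sum>n<N. f n) \<le> suminf f"
    using assms(1,2) by (intro sum_le_suminf) auto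
  moreover have "(\<Sum>n<N. g n) =
      (\<Sum>n<N. f n) + (\<Sum>n<N. if a \<le> n then c * g (n - a) else 0)"
    by (subst sum.distrib[symmetric]) (rule sum.cong[OF refl g])
  ultimately have "(\<Sum>n<N. g n) * (1 - c) \<le> suminf f"
    using shifted by (simp add: algebra_simps)
  then show "(\<Sum>n<N. g n) \<le> suminf f / (1 - c)"
    using assms(5) by (simp add: pos_le_divide_eq)
qed (rule assms(3))

text \<open>The type is kept general so that the same identity serves the real series used for
  absolute convergence and the series in a normed field whose value is computed.\<close>

lemma restricted_partitions_gf_recurrence:
  fixes x :: "'a :: comm_semiring_1"
  assumes "a \<notin> A" "a > 0"
  shows "of_nat (card (restricted_partitions (insert a A) n)) * x ^ n =
           of_nat (card (restricted_partitions A n)) * x ^ n +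
           (if a \<le> n then x ^ a * (of_nat (card (restricted_partitions (insert a A) (n - a))) * x ^ (n - a))
            else 0)"
proof (cases "a \<le> n")
  case True
  then have "x ^ n = x ^ a * x ^ (n - a)"
    by (simp flip: power_add)
  with True show ?thesis
    using card_restricted_partitions_insert[OF assms, of n] by (simp add: distrib_left mult_ac)
next
  case False
  then show ?thesis
    using card_restricted_partitions_insert[OF assms, of n] by simp
qed

lemma summable_restricted_partitions:
  fixes r :: real
  assumes "finite A" "0 \<notin> A" "0 \<le> r" "r < 1"
  shows "summable (\<lambda>n. real (card (restricted_partitions A n)) * r ^ n)"
  using assms(1,2)
proof (induction A rule: finite_induct)
  case empty
  show ?case
    by (rule summable_finite[of "{0}"]) (auto simp: card_restricted_partitions_empty)
next
  case (insert a A)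
  show ?case
  proof (rule summable_shift_recurrence)
    show "summable (\<lambda>n. real (card (restricted_partitions A n)) * r ^ n)"
      using insert by simp
    show "r ^ a < 1"
      using insert assms by (cases a) (auto simp: power_less_one_iff simp del: power_Suc)
    show "real (card (restricted_partitions (insert a A) n)) * r ^ n =
        real (card (restricted_partitions A n)) * r ^ n +
        (if a \<le> n then r ^ a * (real (card (restricted_partitions (insert a A) (n - a))) * r ^ (n - a))
         else 0)" for n
      using insert by (intro restricted_partitions_gf_recurrence) (auto intro: Nat.gr0I)
  qed (use assms in auto)
qed

text \<open>Absolute convergence comes first, from the real series at \<open>norm x\<close>. Only
  then can the recurrence be summed to an equation for the value \<open>t\<close>, namely t = F +
  x^a t, which is solvable because x^a is not 1.\<close>

lemma sums_restricted_partitions: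
  fixes x :: "'a :: {real_normed_field, banach}"
  assumes "finite A" "0 \<notin> A" "norm x < 1"
  shows "(\<lambda>n. of_nat (card (restricted_partitions A n)) * x ^ n) sums (1 / (\<Prod>a\<in>A. 1 - x ^ a))"
  using assms(1,2)
proof (induction A rule: finite_induct)
  case empty
  show ?case
    using sums_finite[of "{0}" "\<lambda>n. of_nat (card (restricted_partitions {} n)) * x ^ n"]
    by (simp add: card_restricted_partitions_empty)
next
  case (insert a A)
  let ?f = "\<lambda>n. of_nat (card (restricted_partitions A n)) * x ^ n"
  let ?g = "\<lambda>n. of_nat (card (restricted_partitions (insert a A) n)) * x ^ n"
  have "a > 0" using insert by (auto intro: Nat.gr0I)
  have "summable ?g"
    using summable_restricted_partitions[of "insert a A" "norm x"] insert assms
    by (intro summable_norm_cancel[of ?g]) (auto simp: norm_mult norm_power)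
  then obtain t where t: "?g sums t" by (auto simp: summable_def)
  \<comment> \<open>The first \<open>a\<close> terms vanish, so dropping them leaves the sum
    unchanged.\<close>
  have "(\<lambda>n. if a \<le> n then x ^ a * ?g (n - a) else 0) sums (x ^ a * t)"
    by (subst sums_zero_iff_shift[of a, symmetric]) (use sums_mult[OF t] in auto)
  moreover have "?f sums (1 / (\<Prod>a\<in>A. 1 - x ^ a))"
    using insert by auto
  ultimately have "(\<lambda>n. ?f n + (if a \<le> n then x ^ a * ?g (n - a) else 0)) sums
      (1 / (\<Prod>a\<in>A. 1 - x ^ a) + x ^ a * t)"
    using sums_add by blast
  moreover have "?f n + (if a \<le> n then x ^ a * ?g (n - a) else 0) = ?g n" for n
    by (rule restricted_partitions_gf_recurrence[symmetric]) fact+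
  ultimately have "1 / (\<Prod>a\<in>A. 1 - x ^ a) + x ^ a * t = t"
    using t sums_unique2 by fastforce
  moreover have "x ^ a \<noteq> 1"
    using assms \<open>a > 0\<close> norm_power[of x a] power_less_one_iff[of "norm x" a] by auto
  moreover from calculation have "t * (1 - x ^ a) = 1 / (\<Prod>a\<in>A. 1 - x ^ a)"
    by (simp add: algebra_simps)
  ultimately have "t = 1 / (\<Prod>a\<in>A. 1 - x ^ a) / (1 - x ^ a)"
    by (metis eq_divide_eq right_minus_eq)
  then show ?case
    using t insert by (simp add: mult.commute)
qed

section \<open>Passage to all odd parts\<close>

lemma odd_prod_convergent:
  fixes x :: complex
  assumes "norm x < 1"
  obtains L where "L \<noteq> 0" "(\<lambda>m. \<Prod>k<m. 1 - x ^ (2 * k + 1)) \<longlonglongrightarrow> L"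
proof -
  have less: "norm (x ^ (2 * k + 1)) < 1" for k
    using assms power_less_one_iff[of "norm x" "2 * k + 1"] by (simp add: norm_power del: power_Suc)
  \<comment> \<open>These are the norms of x^(2k+1), a geometric series of ratio
    \<open>norm x ^ 2\<close>.\<close>
  have "summable (\<lambda>k. norm x * (norm x ^ 2) ^ k)"
    using assms by (intro summable_mult summable_geometric) (simp add: power_less_one_iff)
  then have "summable (\<lambda>k. norm (- (x ^ (2 * k + 1))))"
    by (simp add: norm_mult norm_power power_mult)
  moreover have nz: "1 - x ^ (2 * k + 1) \<noteq> 0" for k
    using less[of k] by auto
  ultimately have conv: "convergent_prod (\<lambda>k. 1 + - (x ^ (2 * k + 1)))"
    by (intro summable_imp_convergent_prod_complex) (auto simp del: power_Suc)
  let ?L = "prodinf (\<lambda>k. 1 + - (x ^ (2 * k + 1)))"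
  \<comment> \<open>The limit of an infinite product is taken over k \<le> m, so one index shift is
    needed to reach the products over k < m.\<close>
  have "(\<lambda>m. \<Prod>k<Suc m. 1 - x ^ (2 * k + 1)) \<longlonglongrightarrow> ?L"
    using convergent_prod_LIMSEQ[OF conv] unfolding lessThan_Suc_atMost by simp
  then have "(\<lambda>m. \<Prod>k<m. 1 - x ^ (2 * k + 1)) \<longlonglongrightarrow> ?L"
    by (rule LIMSEQ_imp_Suc)
  \<comment> \<open>A convergent product without zero factors has a nonzero value; this permits
    taking reciprocals in the limit below.\<close>
  moreover have "?L \<noteq> 0"
    using conv nz by (intro prodinf_nonzero) auto
  ultimately show ?thesis by (rule that[rotated])
qed

text \<open>The first \<open>m\<close> odd numbers, matching the \<open>m\<close> factors of the
  partial product.\<close>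

abbreviation odd_upto :: "nat \<Rightarrow> nat set" where
  "odd_upto m \<equiv> {p. odd p \<and> p < 2 * m}"

lemma restricted_partitions_odd_upto:
  assumes "n \<le> 2 * m"
  shows "restricted_partitions (odd_upto m) n = restricted_partitions {p. odd p} n"
proof (rule restricted_partitions_cong)
  show "odd_upto m \<inter> {1..n} = {p. odd p} \<inter> {1..n}"
    \<comment> \<open>The boundary case n = 2m is harmless because 2m is even.\<close>
    using assms by (auto simp: order.order_iff_strict)
qed

lemma sums_odd_upto:
  fixes x :: complex
  assumes "norm x < 1"
  shows "(\<lambda>n. of_nat (card (restricted_partitions (odd_upto m) n)) * x ^ n) sums
           (1 / (\<Prod>k<m. 1 - x ^ (2 * k + 1)))"
proof -
  have "(\<Prod>k<m. 1 - x ^ (2 * k + 1)) = (\<Prod>a\<in>odd_upto m. 1 - x ^ a)"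
    by (rule prod.reindex_bij_witness[of _ "\<lambda>a. a div 2" "\<lambda>k. 2 * k + 1"]) (auto elim!: oddE)
  moreover have "finite (odd_upto m)"
    by (rule finite_subset[of _ "{..<2 * m}"]) auto
  ultimately show ?thesis
    using sums_restricted_partitions[of "odd_upto m" x] assms by (simp del: power_Suc)
qed

text \<open>The first N terms agree with those for \<open>odd_upto N\<close>, a nonnegative series
  whose value is the reciprocal of the N-th partial product. These reciprocals converge, so a single
  \<open>K\<close> bounds them all.\<close>

lemma summable_odd_partitions:
  fixes r :: real
  assumes "0 \<le> r" "r < 1"
  shows "summable (\<lambda>n. real (card (restricted_partitions {p. odd p} n)) * r ^ n)"
proof -
  let ?c = "\<lambda>A n. real (card (restricted_partitions A n)) * r ^ n"
  let ?P = "\<lambda>m. \<Prod>k<m. 1 - complex_of_real r ^ (2 * k + 1)"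
  obtain L where L: "L \<noteq> 0" "?P \<longlonglongrightarrow> L"
    using odd_prod_convergent[of "of_real r"] assms by auto
  have "(\<lambda>m. 1 / ?P m) \<longlonglongrightarrow> 1 / L"
    using L by (intro tendsto_divide tendsto_const)
  then have "Bseq (\<lambda>m. 1 / ?P m)"
    by (meson convergentI convergent_imp_Bseq)
  then obtain K where K: "\<And>m. norm (1 / ?P m) \<le> K"
    by (auto simp: Bseq_def)
  show ?thesis
  proof (rule summableI_nonneg_bounded)
    fix N
    have sm: "(\<lambda>n. complex_of_real (?c (odd_upto N) n)) sums (1 / ?P N)"
      using sums_odd_upto[of "of_real r" N] assms by simp
    have summ: "summable (?c (odd_upto N))"
      using assms by (intro summable_restricted_partitions) auto
    have "(\<Sum>n<N. ?c {p. odd p} n) = (\<Sum>n<N. ?c (odd_upto N) n)"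
      by (intro sum.cong refl, subst restricted_partitions_odd_upto) auto
    also have "\<dots> \<le> suminf (?c (odd_upto N))"
      using summ assms by (intro sum_le_suminf) auto
    also have "\<dots> \<le> norm (complex_of_real (suminf (?c (odd_upto N))))"
      by simp
    also have "complex_of_real (suminf (?c (odd_upto N))) = 1 / ?P N"
      using sums_of_real[OF summable_sums[OF summ]] sm by (rule sums_unique2)
    also have "norm (1 / ?P N) \<le> K" by (rule K)
    finally show "(\<Sum>n<N. ?c {p. odd p} n) \<le> K" .
  qed (use assms in simp)
qed

lemma sums_odd_partitions:
  fixes x :: complex
  assumes "norm x < 1"
  shows "(\<lambda>n. of_nat (card (restricted_partitions {p. odd p} n)) * x ^ n) sums
           (1 / lim (\<lambda>m. \<Prod>k<m. 1 - x ^ (2 * k + 1)))"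
proof -
  let ?c = "\<lambda>A n. of_nat (card (restricted_partitions A n)) * x ^ n"
  let ?P = "\<lambda>m. \<Prod>k<m. 1 - x ^ (2 * k + 1)"
  obtain L where L: "L \<noteq> 0" "?P \<longlonglongrightarrow> L"
    using odd_prod_convergent assms by blast
  \<comment> \<open>Each coefficient is already final once m \<ge> n.\<close>
  have ev: "\<forall>\<^sub>F m in sequentially. ?c (odd_upto m) n = ?c {p. odd p} n" for n
    using eventually_ge_at_top[of n]
    by eventually_elim (subst restricted_partitions_odd_upto, auto)
  \<comment> \<open>Fewer allowed parts give fewer partitions, so the final coefficients dominate
    uniformly in \<open>m\<close>.\<close>
  have mono: "card (restricted_partitions (odd_upto m) n) \<le>
               card (restricted_partitions {p. odd p} n)" for m n
    by (intro card_mono finite_restricted_partitions) (auto simp: restricted_partitions_def)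
  have summ: "summable (\<lambda>n. real (card (restricted_partitions {p. odd p} n)) * norm x ^ n)"
    using assms by (intro summable_odd_partitions) auto
  have bound: "norm (?c (odd_upto m) n) \<le> real (card (restricted_partitions {p. odd p} n)) * norm x ^ n"
    for m n
    unfolding norm_mult norm_power norm_of_nat using mono by (intro mult_right_mono) auto
  have tannery: "summable (\<lambda>n. norm (?c {p. odd p} n)) \<and>
      (\<lambda>m. suminf (?c (odd_upto m))) \<longlonglongrightarrow> suminf (?c {p. odd p})"
    by (rule tannerys_theorem[where a = "\<lambda>n m. ?c (odd_upto m) n", THEN conjunct2])
       (rule tendsto_eventually[OF ev], use bound summ in \<open>auto intro!: always_eventually\<close>)
  have "suminf (?c (odd_upto m)) = 1 / ?P m" for m
    using sums_odd_upto[OF assms, of m] by (rule sums_unique[symmetric])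
  then have "(\<lambda>m. 1 / ?P m) \<longlonglongrightarrow> suminf (?c {p. odd p})"
    using tannery by simp
  moreover have "(\<lambda>m. 1 / ?P m) \<longlonglongrightarrow> 1 / L"
    using L by (intro tendsto_divide tendsto_const)
  ultimately have "suminf (?c {p. odd p}) = 1 / L"
    by (rule LIMSEQ_unique)
  moreover have "?c {p. odd p} sums suminf (?c {p. odd p})"
    using tannery by (intro summable_sums summable_norm_cancel[of "?c {p. odd p}"]) simp
  moreover have "lim ?P = L"
    using L(2) by (rule limI)
  ultimately show ?thesis
    by (simp only:)
qed

section \<open>The partitions counted by \<open>rho_o\<close>\<close>

lemma rho_o_partition_form:
  assumes "P \<in> rho_o_partitions n"
  obtains l R where "P = add_mset l R" "n = 2 * l" "l > 0"
    "R \<in> restricted_partitions {p. odd p} l" "\<forall>p \<in># R. p < l"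
proof -
  let ?l = "Max_mset P"
  have "P \<noteq> {#}" using assms by (simp add: rho_o_partitions_def)
  then have l: "?l \<in># P" by simp
  then have P: "P = add_mset ?l (P - {#?l#})" by simp
  have R: "P - {#?l#} \<in> partitions_of ?l" "\<forall>p \<in># P - {#?l#}. odd p \<and> p < ?l"
    and Pn: "P \<in> partitions_of n"
    using assms by (simp_all add: rho_o_partitions_def Let_def)
  have "n = 2 * ?l"
    using R(1) Pn arg_cong[OF P, of sum_mset] by (simp add: partitions_of_def)
  moreover have "?l > 0" using Pn l by (simp add: partitions_of_def)
  ultimately show ?thesis
    using P R by (intro that[of ?l "P - {#?l#}"]) (auto simp: restricted_partitions_def)
qed

text \<open>The strict bound on the parts of \<open>R\<close> does double duty: it makes
  \<open>l\<close> the maximum and keeps its multiplicity at one.\<close>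

lemma add_mset_rho_o_partition:
  assumes "R \<in> restricted_partitions {p. odd p} l" "\<forall>p \<in># R. p < l" "l > 0"
  shows "add_mset l R \<in> rho_o_partitions (2 * l)"
proof -
  have "Max_mset (add_mset l R) = l"
    using assms(2) by (intro Max_eqI) auto
  moreover have "l \<notin># R" using assms(2) by auto
  ultimately show ?thesis
    using assms
    by (auto simp: rho_o_partitions_def restricted_partitions_def partitions_of_def Let_def
        not_in_iff)
qed

lemma rho_o_odd:
  assumes "odd n"
  shows "rho_o n = 0"
proof -
  have "rho_o_partitions n = {}"
    using assms by (auto elim: rho_o_partition_form)
  then show ?thesis by (simp add: rho_o_def)
qed

lemma rho_o_0: "rho_o 0 = 0"
proof -
  have "rho_o_partitions 0 = {}"
    by (auto elim: rho_o_partition_form)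
  then show ?thesis by (simp add: rho_o_def)
qed

text \<open>Removing \<open>l\<close> leaves positive parts with sum 0, hence no parts.\<close>

lemma partition_with_part_total:
  assumes "R \<in> partitions_of l" "l \<in># R"
  shows "R = {#l#}"
proof -
  have "sum_mset (R - {#l#}) = 0"
    using assms sum_mset.remove[OF assms(2)] by (simp add: partitions_of_def)
  moreover have "0 \<notin># R - {#l#}"
    using assms(1) by (auto simp: partitions_of_def dest: in_diffD)
  ultimately have "R - {#l#} = {#}"
    by (metis multiset_nonemptyE sum_mset_0_iff)
  with assms(2) show ?thesis by (metis insert_DiffM)
qed

text \<open>The correction accounts for \<open>{#l#}\<close>, the only partition of \<open>l\<close>
  having a part that is not below \<open>l\<close>; it has odd parts exactly when \<open>l\<close>
  is odd. Placing it on the left avoids truncated subtraction.\<close>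

lemma rho_o_double:
  assumes "l > 0"
  shows "rho_o (2 * l) + (if odd l then 1 else 0) = card (restricted_partitions {p. odd p} l)"
proof -
  let ?S = "{R \<in> restricted_partitions {p. odd p} l. \<forall>p \<in># R. p < l}"
  let ?T = "if odd l then {{#l#}} else {}"
  \<comment> \<open>The size 2l determines the largest part, so the same \<open>l\<close> is
    adjoined throughout.\<close>
  have "rho_o_partitions (2 * l) = add_mset l ` ?S"
    using assms by (auto elim!: rho_o_partition_form intro!: add_mset_rho_o_partition)
  then have "rho_o (2 * l) = card ?S"
    by (simp add: rho_o_def card_image inj_on_def)
  moreover have "restricted_partitions {p. odd p} l = ?S \<union> ?T"
  proof (intro equalityI subsetI)
    fix R assume R: "R \<in> restricted_partitions {p. odd p} l"
    then have "R \<in> partitions_of l" by (simp add: restricted_partitions_def)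
    with R show "R \<in> ?S \<union> ?T"
      using part_le[of R l] partition_with_part_total[of R l]
      by (cases "l \<in># R") (fastforce simp: restricted_partitions_def nat_less_le)+
  qed (use assms in \<open>auto simp: restricted_partitions_def partitions_of_def split: if_splits\<close>)
  moreover have "card (?S \<union> ?T) = card ?S + card ?T"
    by (rule card_Un_disjoint) auto
  ultimately show ?thesis by simp
qed

section \<open>Assembling the generating function\<close>

lemma sums_odd_powers:
  fixes x :: complex
  assumes "norm x < 1"
  shows "(\<lambda>l. if odd l then x ^ l else 0) sums (x / (1 - x ^ 2))"
proof -
  have "(\<lambda>k. x * (x ^ 2) ^ k) sums (x * (1 / (1 - x ^ 2)))"
    using assms by (intro sums_mult geometric_sums) (simp add: norm_power power_less_one_iff)
  moreover have "strict_mono (\<lambda>k :: nat. 2 * k + 1)"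
    by (simp add: strict_mono_def)
  ultimately show ?thesis
    by (subst sums_mono_reindex[of "\<lambda>k. 2 * k + 1", symmetric])
       (auto simp: power_mult elim!: oddE)
qed

theorem theorem3:
  fixes q :: complex
  assumes "norm q < 1"
  shows "(\<lambda>n. of_nat (rho_o n) * q ^ n) sums
           (1 / qpoch_inf (q ^ 2) (q ^ 4) - q ^ 2 / (1 - q ^ 4) - 1)"
proof -
  let ?x = "q ^ 2"
  let ?c = "\<lambda>l. card (restricted_partitions {p. odd p} l)"
  have x: "norm ?x < 1"
    using assms by (simp add: norm_power power_less_one_iff)
  \<comment> \<open>Exponents agree: 2 + 4k = 2(2k + 1).\<close>
  have "qpoch ?x (q ^ 4) = (\<lambda>m. \<Prod>k<m. 1 - ?x ^ (2 * k + 1))"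
    by (simp add: qpoch_def fun_eq_iff flip: power_mult power_add)
  then have "(\<lambda>l. of_nat (?c l) * ?x ^ l) sums (1 / qpoch_inf ?x (q ^ 4))"
    using sums_odd_partitions[OF x] by (simp add: qpoch_inf_def)
  moreover have "(\<lambda>l. if odd l then ?x ^ l else 0) sums (?x / (1 - q ^ 4))"
    using sums_odd_powers[OF x] by (simp flip: power_mult)
  \<comment> \<open>At l = 0 the empty partition contributes 1 to the odd-part series, whereas
    \<open>rho_o 0\<close> is 0; this is the final -1.\<close>
  moreover have "(\<lambda>l. if l = 0 then 1 else 0) sums (1 :: complex)"
    using sums_single[of 0 "\<lambda>_. 1 :: complex"] by simp
  ultimately have "(\<lambda>l. of_nat (?c l) * ?x ^ l - (if odd l then ?x ^ l else 0)
      - (if l = 0 then 1 else 0)) sums (1 / qpoch_inf ?x (q ^ 4) - ?x / (1 - q ^ 4) - 1)"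
    by (intro sums_diff)
  moreover have "of_nat (?c l) * ?x ^ l - (if odd l then ?x ^ l else 0) - (if l = 0 then 1 else 0)
      = of_nat (rho_o (2 * l)) * q ^ (2 * l)" for l
  proof (cases "l = 0")
    case True
    \<comment> \<open>The range \<open>{1..0}\<close> is empty, so any two sets of parts agree on
      it.\<close>
    have "restricted_partitions {p. odd p} 0 = restricted_partitions {} 0"
      by (rule restricted_partitions_cong) simp
    then have "?c 0 = 1"
      by (simp add: card_restricted_partitions_empty)
    with True show ?thesis by (simp add: rho_o_0)
  next
    case False
    then have "of_nat (?c l) = (of_nat (rho_o (2 * l) + (if odd l then 1 else 0)) :: complex)"
      using rho_o_double[of l] by simp
    with False show ?thesis by (simp add: distrib_right flip: power_mult)
  qed
  ultimately have "(\<lambda>l. of_nat (rho_o (2 * l)) * q ^ (2 * l)) sums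
      (1 / qpoch_inf ?x (q ^ 4) - ?x / (1 - q ^ 4) - 1)"
    by simp
  \<comment> \<open>The terms at odd indices vanish, so the sum over l at the indices 2l is the full
    series.\<close>
  moreover have "strict_mono (\<lambda>l :: nat. 2 * l)"
    by (simp add: strict_mono_def)
  moreover have "of_nat (rho_o n) * q ^ n = 0" if "n \<notin> range (\<lambda>l. 2 * l)" for n
  proof -
    have "odd n" using that by (auto elim: evenE)
    then show ?thesis by (simp add: rho_o_odd)
  qed
  ultimately show ?thesis
    using sums_mono_reindex[of "\<lambda>l. 2 * l" "\<lambda>n. of_nat (rho_o n) * q ^ n"] by blast
qed

end
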